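(* Let $G$ and $H$ be connected graphs, each with at least two vertices. Let $r$ be the maximum number of vertices of an induced path in $G$ whose vertex set is cycle convex in $G$, and let $s$ be the maximum number of vertices of an induced path in $H$ whose vertex set is cycle convex in $H$. Then $\operatorname{car}(G\,\square\,H)\geq \max\{r+s-1,\ \operatorname{car}(G)+\operatorname{car}(H)-1\}$.
   Context: All graphs are finite, simple and undirected; $F[X]$ denotes the subgraph of $F$ induced by $X$. The Cartesian product $G\,\square\,H$ has vertex set $V(G)\times V(H)$, with $(g_1,h_1)$ adjacent to $(g_2,h_2)$ iff either $g_1g_2\in E(G)$ and $h_1=h_2$, or $g_1=g_2$ and $h_1h_2\in E(H)$. In a graph $F$, a set $S\subseteq V(F)$ is cycle convex if for every $u\in V(F)\setminus S$ the graph $F[S\cup\{u\}]$ contains no cycle passing through $u$; the cycle convex hull $\langle S\rangle$ is the smallest cycle convex set containing $S$; $S$ is Carathéodory independent if there is $p\in\langle S\rangle$ with $p\notin \bigcup_{a\in S}\langle S\setminus\{a\}\rangle$; and $\operatorname{car}(F)$ is the maximum cardinality of a Carathéodory independent set of $F$. *)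

theory Defs
  imports "Graph_Theory.Graph_Theory"
begin

text \<open>
  A finite simple undirected graph is a \<open>pair_graph\<close>: every edge is represented by the two
  opposite arcs between its ends.
\<close>

definition cartesian_product ::
    "'a pair_pre_digraph \<Rightarrow> 'b pair_pre_digraph \<Rightarrow> ('a \<times> 'b) pair_pre_digraph"
    (infixr \<open>\<box>\<close> 75) where
  "G \<box> H = \<lparr> pverts = pverts G \<times> pverts H,
     parcs = {((g1, h1), (g2, h2)) | g1 h1 g2 h2.
       (g1, g2) \<in> parcs G \<and> h1 = h2 \<and> h1 \<in> pverts H \<or>
       g1 = g2 \<and> g1 \<in> pverts G \<and> (h1, h2) \<in> parcs H} \<rparr>"

text \<open>
  The constant \<open>pre_digraph.cycle\<close> also admits the closed walk of length two that traverses a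
  single edge back and forth, which is not a cycle of the undirected graph; hence the length bound.
\<close>

definition cycle_through :: "('a, 'b) pre_digraph \<Rightarrow> 'a \<Rightarrow> bool" where
  "cycle_through F u \<longleftrightarrow>
     (\<exists>c. pre_digraph.cycle F c \<and> 3 \<le> length c \<and> u \<in> tail F ` set c)"

definition cycle_convex :: "'a pair_pre_digraph \<Rightarrow> 'a set \<Rightarrow> bool" where
  "cycle_convex F S \<longleftrightarrow> S \<subseteq> pverts F \<and>
     (\<forall>u \<in> pverts F - S. \<not> cycle_through (with_proj F \<restriction> (S \<union> {u})) u)"

definition cycle_hull :: "'a pair_pre_digraph \<Rightarrow> 'a set \<Rightarrow> 'a set" where
  "cycle_hull F S = cycle_convex F hull S"

definition caratheodory_independent :: "'a pair_pre_digraph \<Rightarrow> 'a set \<Rightarrow> bool" where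
  "caratheodory_independent F S \<longleftrightarrow> S \<subseteq> pverts F \<and>
     (\<exists>p \<in> cycle_hull F S. p \<notin> (\<Union>a\<in>S. cycle_hull F (S - {a})))"

definition car :: "'a pair_pre_digraph \<Rightarrow> nat" where
  "car F = Max {card S | S. caratheodory_independent F S}"

text \<open>
  The path is induced: the only edges inside \<open>X\<close> are those it traverses. For \<open>p = []\<close> this is
  the path with a single vertex.
\<close>

definition induced_path_verts :: "'a pair_pre_digraph \<Rightarrow> 'a set \<Rightarrow> bool" where
  "induced_path_verts F X \<longleftrightarrow>
     (\<exists>u p v. pre_digraph.apath (with_proj F) u p v \<and>
        X = set (pre_digraph.awalk_verts (with_proj F) u p) \<and>
        arcs (with_proj F \<restriction> X) = set p \<union> (set p)\<inverse>)"

definition max_convex_induced_path :: "'a pair_pre_digraph \<Rightarrow> nat" where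
  "max_convex_induced_path F = Max {card X | X. induced_path_verts F X \<and> cycle_convex F X}"


text \<open>The hull is the smallest cycle convex set containing a given set of vertices.\<close>

lemma cycle_through_mono:
  assumes "cycle_through (with_proj F \<restriction> A) u" "A \<subseteq> B"
  shows "cycle_through (with_proj F \<restriction> B) u"
proof -
  have cas: "pre_digraph.cas (with_proj F \<restriction> C) = pcas" for C
  proof (unfold fun_eq_iff, intro allI)
    fix u es v show "pre_digraph.cas (with_proj F \<restriction> C) u es v = pcas u es v"
      by (induct es arbitrary: u) (auto simp: pre_digraph.cas.simps induce_subgraph_def)
  qed
  have aw: "pre_digraph.awalk_verts (with_proj F \<restriction> C) = pawalk_verts" for C
  proof (unfold fun_eq_iff, intro allI)
    fix u es show "pre_digraph.awalk_verts (with_proj F \<restriction> C) u es = pawalk_verts u es"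
      by (induct es arbitrary: u) (auto simp: pre_digraph.awalk_verts.simps induce_subgraph_def)
  qed
  from assms(1) obtain c x where c:
    "x \<in> A" "set c \<subseteq> arcs (with_proj F \<restriction> A)" "pcas x c x"
    "distinct (tl (pawalk_verts x c))" "c \<noteq> []" "3 \<le> length c" "u \<in> fst ` set c"
    unfolding cycle_through_def pre_digraph.cycle_def pre_digraph.awalk_def cas aw
    by (auto simp: induce_subgraph_def)
  moreover have "arcs (with_proj F \<restriction> A) \<subseteq> arcs (with_proj F \<restriction> B)"
    using assms(2) by (auto simp: induce_subgraph_def)
  ultimately have "pre_digraph.cycle (with_proj F \<restriction> B) c"
    using assms(2) unfolding pre_digraph.cycle_def pre_digraph.awalk_def cas aw
    by (intro exI[of _ x]) auto
  with c show ?thesis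
    unfolding cycle_through_def by (intro exI[of _ c]) (simp add: induce_subgraph_def)
qed

lemma cycle_convex_pverts: "cycle_convex F (pverts F)"
  by (simp add: cycle_convex_def)

lemma cycle_convex_cycle_hull:
  assumes "S \<subseteq> pverts F"
  shows "cycle_convex F (cycle_hull F S)"
  unfolding cycle_convex_def
proof (intro conjI ballI)
  show "cycle_hull F S \<subseteq> pverts F"
    unfolding cycle_hull_def by (rule hull_minimal[where S="cycle_convex F", OF assms cycle_convex_pverts])
next
  fix u assume u: "u \<in> pverts F - cycle_hull F S"
  then obtain T where T: "cycle_convex F T" "S \<subseteq> T" "u \<notin> T"
    unfolding cycle_hull_def hull_def by auto
  have sub: "cycle_hull F S \<union> {u} \<subseteq> T \<union> {u}"
    unfolding cycle_hull_def using hull_minimal[where S="cycle_convex F", OF T(2,1)] by auto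
  have "\<not> cycle_through (with_proj F \<restriction> (T \<union> {u})) u"
    using T(1,3) u unfolding cycle_convex_def by simp
  then show "\<not> cycle_through (with_proj F \<restriction> (cycle_hull F S \<union> {u})) u"
    using cycle_through_mono[OF _ sub] by (rule contrapos_nn)
qed

lemma subset_cycle_hull: "S \<subseteq> cycle_hull F S"
  unfolding cycle_hull_def by (rule hull_subset)

lemma cycle_hull_minimal: "S \<subseteq> T \<Longrightarrow> cycle_convex F T \<Longrightarrow> cycle_hull F S \<subseteq> T"
  unfolding cycle_hull_def by (rule hull_minimal)

end

theory Submission
  imports Defs
begin

text \<open>
  A vertex \<open>u\<close> outside \<open>S\<close> violates convexity iff it has two neighbours in one component of \<open>S\<close>.
  Hence a union of two sets with no edge between them is convex iff both of them are.

  Both bounds come from a cross \<open>X \<times> {y} \<union> {x} \<times> Y\<close> in the product. When the hulls of \<open>X\<close> and \<open>Y\<close>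
  are connected, closing up squares shows that the hull of the cross contains
  \<open>\<langle>X\<rangle> \<times> \<langle>Y\<rangle>\<close>, in particular \<open>(p, q)\<close> for \<open>p \<in> \<langle>X\<rangle>\<close> and \<open>q \<in> \<langle>Y\<rangle>\<close>. Without the centre, the cross
  lies in the convex set \<open>\<langle>X - {x}\<rangle> \<times> {y} \<union> {x} \<times> \<langle>Y - {y}\<rangle>\<close>; without \<open>(a, y)\<close>, where \<open>a \<noteq> x\<close>, it
  lies in the convex set \<open>C \<times> \<langle>Y\<rangle> \<union> (\<langle>X - {a}\<rangle> - C) \<times> {y}\<close>, where \<open>C\<close> is the component of \<open>x\<close> in
  \<open>\<langle>X - {a}\<rangle>\<close>. Neither contains \<open>(p, q)\<close> if \<open>p \<noteq> x\<close>, \<open>q \<noteq> y\<close> and \<open>p \<notin> C\<close>. Two kinds of sets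
  satisfy this: Caratheodory independent sets with witness \<open>p\<close> and any other element \<open>x\<close>, and convex
  induced paths with distinct ends \<open>x\<close> and \<open>p\<close>. If no convex induced path has two vertices, then
  every edge lies in a triangle and is itself a Caratheodory independent set; so each factor always
  has such a set with at least two vertices, which also covers Caratheodory number 1.
\<close>

section \<open>Reachability and cycles in induced subgraphs\<close>

lemma (in wf_digraph) awalk_verts_eq_Cons_heads:
  assumes "awalk u p v"
  shows "awalk_verts u p = u # map (head G) p"
  using assms by (induct p arbitrary: u) (auto simp: awalk_Cons_iff)

lemma (in wf_digraph) cycle_through_iff_awalk:
  "cycle_through G u \<longleftrightarrow> (\<exists>c. awalk u c u \<and> distinct (map (head G) c) \<and> 3 \<le> length c)"
proof
  assume "cycle_through G u"
  then obtain v c where c: "awalk v c v" "distinct (tl (awalk_verts v c))" "3 \<le> length c"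
      "u \<in> tail G ` set c"
    unfolding cycle_through_def cycle_def by blast
  then have "u \<in> set (awalk_verts v c)"
    using awalk_verts_arc1 by blast
  with c(1) obtain q r where qr: "c = q @ r" "awalk u (r @ q) u"
    by (rule rotate_awalkE)
  moreover have "tl (awalk_verts v c) = map (head G) c"
    using c(1) by (simp add: awalk_verts_eq_Cons_heads)
  then have "distinct (map (head G) (r @ q))"
    using c(2) qr(1) by auto
  ultimately show "\<exists>c. awalk u c u \<and> distinct (map (head G) c) \<and> 3 \<le> length c"
    using c(3) by (intro exI[of _ "r @ q"]) simp
next
  assume "\<exists>c. awalk u c u \<and> distinct (map (head G) c) \<and> 3 \<le> length c"
  then obtain c where c: "awalk u c u" "distinct (map (head G) c)" "3 \<le> length c"
    by blast
  then have "cycle c"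
    unfolding cycle_def by (auto simp: awalk_verts_eq_Cons_heads)
  moreover have "u \<in> tail G ` set c"
    using c(1,3) by (cases c) (auto simp: awalk_Cons_iff)
  ultimately show "cycle_through G u"
    unfolding cycle_through_def using c(3) by blast
qed

lemma (in wf_digraph) reachable_image:
  assumes "x \<rightarrow>\<^sup>*\<^bsub>G\<^esub> y"
    and "wf_digraph G'"
    and "\<And>a. a \<in> verts G \<Longrightarrow> f a \<in> verts G'"
    and "\<And>a b. a \<rightarrow>\<^bsub>G\<^esub> b \<Longrightarrow> f a \<rightarrow>\<^sup>*\<^bsub>G'\<^esub> f b"
  shows "f x \<rightarrow>\<^sup>*\<^bsub>G'\<^esub> f y"
  using assms(1)
proof (induct rule: reachable_induct)
  case base
  then show ?case using assms(2,3) wf_digraph.reachable_refl by metis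
next
  case (step y z)
  then show ?case using assms(2,4) wf_digraph.reachable_trans by metis
qed

lemma (in sym_digraph) strongly_connectedI_reachable_from:
  assumes "r \<in> verts G" and "\<And>v. v \<in> verts G \<Longrightarrow> r \<rightarrow>\<^sup>*\<^bsub>G\<^esub> v"
  shows "strongly_connected G"
proof
  show "verts G \<noteq> {}" using assms(1) by blast
  show "v \<rightarrow>\<^sup>*\<^bsub>G\<^esub> w" if "v \<in> verts G" "w \<in> verts G" for v w
    using that reachable_trans[OF symmetric_reachable'[OF assms(2)] assms(2)] by blast
qed

lemma (in sym_digraph) strongly_connected_if_spanning_vwalk:
  assumes walk: "vwalk xs G" and spanning: "set xs = verts G"
  shows "strongly_connected G"
proof (rule strongly_connectedI_reachable_from)
  show "hd xs \<in> verts G"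
    using walk by (auto simp: vwalk_def intro: hd_in_set[THEN subsetD[rotated]])
  fix v assume "v \<in> verts G"
  then obtain ys zs where "xs = ys @ v # zs"
    using spanning split_list by metis
  then have xs: "xs = (ys @ [v]) @ zs" by simp
  then have "vwalk (ys @ [v]) G"
    using vwalkI_append_l[of "ys @ [v]" zs G] walk by simp
  moreover have "hd (ys @ [v]) = hd xs"
    unfolding xs by (cases ys) auto
  ultimately show "hd xs \<rightarrow>\<^sup>*\<^bsub>G\<^esub> v"
    unfolding reachable_vwalk_conv by auto
qed

lemma dominates_induce_subgraph_iff:
  "x \<rightarrow>\<^bsub>with_proj F \<restriction> S\<^esub> y \<longleftrightarrow> (x, y) \<in> parcs F \<and> x \<in> S \<and> y \<in> S"
  by (force simp: arcs_ends_conv)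

lemma arcs_induce_subgraph_with_proj: "arcs (with_proj F \<restriction> S) = parcs F \<inter> S \<times> S"
  by auto

lemma (in pair_sym_digraph) sym_digraph_induce_subgraph: "sym_digraph (G \<restriction> S)"
proof -
  have "symmetric (G \<restriction> S)"
    by (auto simp: symmetric_def sym_def dominates_induce_subgraph_iff arcs_symmetric)
  then show ?thesis using wellformed_induce_subgraph wf_digraph.sym_digraphI by blast
qed

lemma (in pair_graph) cycle_through_insertD:
  assumes "cycle_through (G \<restriction> insert u S) u"
  obtains x y where "(u, x) \<in> parcs G" "(u, y) \<in> parcs G" "x \<noteq> y" "x \<rightarrow>\<^sup>*\<^bsub>G \<restriction> S\<^esub> y"
proof -
  interpret S: sym_digraph "G \<restriction> S" by (rule sym_digraph_induce_subgraph)
  interpret K: sym_digraph "G \<restriction> insert u S" by (rule sym_digraph_induce_subgraph)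
  obtain c where c: "K.awalk u c u" "distinct (map snd c)" "3 \<le> length c"
    using assms unfolding K.cycle_through_iff_awalk by auto
  then obtain e d where "c = e # d" by (cases c) auto
  moreover from this obtain p f where "d = p @ [f]"
    using c(3) by (cases d rule: rev_cases) auto
  ultimately have c_eq: "c = e # p @ [f]" by simp
  obtain x y where ends: "e = (u, x)" "f = (y, u)"
    using c(1) unfolding c_eq by (cases e, cases f) (auto simp: K.awalk_simps)
  have arcs: "(u, x) \<in> parcs G" "(y, u) \<in> parcs G" and p: "K.awalk x p y"
    using c(1) unfolding c_eq ends by (auto simp: K.awalk_simps)
  have distinct: "u \<notin> insert x (snd ` set p)" "x \<notin> snd ` set p"
    using c(2) unfolding c_eq ends by auto
  have verts: "K.awalk_verts x p = x # map snd p"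
    using K.awalk_verts_eq_Cons_heads[OF p] by simp
  have "set (x # map snd p) \<subseteq> insert u S" "last (x # map snd p) = y"
    using p unfolding verts[symmetric] by (auto elim!: K.awalkE')
  then have in_S: "set (x # map snd p) \<subseteq> S" and "y \<in> snd ` set p \<or> p = []"
    using distinct last_in_set[of "map snd p"] by (auto split: if_splits)
  then have "x \<noteq> y"
    using distinct c(3) unfolding c_eq by auto
  moreover have "(G \<restriction> insert u S) \<restriction> S = G \<restriction> S"
    by (auto simp: induce_subgraph_def)
  then have "S.awalk x p y"
    using K.awalk_induce[OF p, of S] in_S verts by simp
  ultimately show ?thesis
    using that arcs arcs_symmetric S.reachable_awalkI by metis
qed

lemma (in pair_graph) cycle_through_insertI:
  assumes "u \<notin> S"
    and arcs: "(u, x) \<in> parcs G" "(u, y) \<in> parcs G"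
    and "x \<noteq> y" and reach: "x \<rightarrow>\<^sup>*\<^bsub>G \<restriction> S\<^esub> y"
  shows "cycle_through (G \<restriction> insert u S) u"
proof -
  interpret S: sym_digraph "G \<restriction> S" by (rule sym_digraph_induce_subgraph)
  interpret K: sym_digraph "G \<restriction> insert u S" by (rule sym_digraph_induce_subgraph)
  obtain p where p: "S.apath x p y"
    using reach unfolding S.reachable_apath by blast
  then have walk: "S.awalk x p y" by (rule S.awalkI_apath)
  have "subgraph (G \<restriction> S) (G \<restriction> insert u S)"
    by (intro subgraphI) (auto simp: compatible_def S.wf_digraph_axioms K.wf_digraph_axioms)
  then have "K.awalk x p y"
    using walk K.subgraph_awalk_imp_awalk by blast
  moreover have "x \<in> S" "y \<in> S"
    using S.reachable_in_verts[OF reach] by auto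
  ultimately have "K.awalk u ((u, x) # p @ [(y, u)]) u"
    using arcs arcs_symmetric by (auto simp: K.awalk_simps)
  moreover have "distinct (map snd ((u, x) # p @ [(y, u)]))"
  proof -
    have verts: "S.awalk_verts x p = x # map snd p"
      using S.awalk_verts_eq_Cons_heads[OF walk] by simp
    have "distinct (x # map snd p)"
      using p unfolding verts[symmetric] by (simp add: S.apath_def)
    moreover have "set (x # map snd p) \<subseteq> S"
      using walk unfolding verts[symmetric] by (auto elim!: S.awalkE')
    ultimately show ?thesis
      using \<open>u \<notin> S\<close> by auto
  qed
  moreover have "p \<noteq> []"
    using walk \<open>x \<noteq> y\<close> by (auto simp: S.awalk_Nil_iff)
  then have "3 \<le> length ((u, x) # p @ [(y, u)])"
    by (cases p) auto
  ultimately show ?thesis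
    unfolding K.cycle_through_iff_awalk by auto
qed

section \<open>Cycle convexity\<close>

lemma (in pair_graph) cycle_convex_iff:
  "cycle_convex G S \<longleftrightarrow> S \<subseteq> pverts G \<and>
     (\<forall>u x y. (u, x) \<in> parcs G \<longrightarrow> (u, y) \<in> parcs G \<longrightarrow> x \<noteq> y \<longrightarrow> x \<rightarrow>\<^sup>*\<^bsub>G \<restriction> S\<^esub> y \<longrightarrow> u \<in> S)"
proof -
  have "cycle_through (G \<restriction> (S \<union> {u})) u \<longleftrightarrow>
      (\<exists>x y. (u, x) \<in> parcs G \<and> (u, y) \<in> parcs G \<and> x \<noteq> y \<and> x \<rightarrow>\<^sup>*\<^bsub>G \<restriction> S\<^esub> y)" if "u \<notin> S" for u
    using cycle_through_insertD[of u S] cycle_through_insertI[OF that]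
    by (metis Un_insert_right sup_bot_right)
  then show ?thesis
    unfolding cycle_convex_def using in_arcsD1 by blast
qed

lemma (in pair_graph) cycle_convexI:
  assumes "S \<subseteq> pverts G"
    and "\<And>u x y. (u, x) \<in> parcs G \<Longrightarrow> (u, y) \<in> parcs G \<Longrightarrow> x \<noteq> y \<Longrightarrow> x \<rightarrow>\<^sup>*\<^bsub>G \<restriction> S\<^esub> y \<Longrightarrow> u \<in> S"
  shows "cycle_convex G S"
  unfolding cycle_convex_iff using assms by blast

lemma (in pair_graph) cycle_convexD:
  assumes "cycle_convex G S" "(u, x) \<in> parcs G" "(u, y) \<in> parcs G" "x \<noteq> y" "x \<rightarrow>\<^sup>*\<^bsub>G \<restriction> S\<^esub> y"
  shows "u \<in> S"
  using assms unfolding cycle_convex_iff by blast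

lemma reachable_induce_subgraph_verts:
  assumes "x \<rightarrow>\<^sup>*\<^bsub>F \<restriction> S\<^esub> y"
  shows "x \<in> S" "y \<in> S"
  using assms by (auto elim: reachable_in_vertsE)

lemma (in pair_graph) cycle_convex_empty: "cycle_convex G {}"
  by (rule cycle_convexI) (auto dest: reachable_induce_subgraph_verts)

lemma (in pair_graph) cycle_convex_singleton:
  assumes "v \<in> pverts G"
  shows "cycle_convex G {v}"
  by (rule cycle_convexI) (use assms in \<open>auto dest: reachable_induce_subgraph_verts\<close>)

lemma cycle_hull_mono: "S \<subseteq> T \<Longrightarrow> cycle_hull F S \<subseteq> cycle_hull F T"
  unfolding cycle_hull_def by (rule hull_mono)

lemma cycle_hull_eq: "cycle_convex F S \<Longrightarrow> cycle_hull F S = S"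
  by (simp add: cycle_hull_minimal subset_antisym subset_cycle_hull)

definition separated :: "'a pair_pre_digraph \<Rightarrow> 'a set \<Rightarrow> 'a set \<Rightarrow> bool" where
  "separated F C D \<longleftrightarrow> (\<forall>x\<in>C. \<forall>y\<in>D. x \<noteq> y \<and> (x, y) \<notin> parcs F \<and> (y, x) \<notin> parcs F)"

lemma separated_commute: "separated F C D \<longleftrightarrow> separated F D C"
  unfolding separated_def by auto

lemma separated_mono: "separated F C D \<Longrightarrow> C' \<subseteq> C \<Longrightarrow> D' \<subseteq> D \<Longrightarrow> separated F C' D'"
  unfolding separated_def by blast

lemma (in pair_graph) reachable_separated:
  assumes "separated G C D" and "x \<rightarrow>\<^sup>*\<^bsub>G \<restriction> (C \<union> D)\<^esub> y" and "x \<in> C"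
  shows "x \<rightarrow>\<^sup>*\<^bsub>G \<restriction> C\<^esub> y"
proof -
  interpret C: sym_digraph "G \<restriction> C" by (rule sym_digraph_induce_subgraph)
  interpret CD: sym_digraph "G \<restriction> (C \<union> D)" by (rule sym_digraph_induce_subgraph)
  show ?thesis
    using assms(2)
  proof (induct rule: CD.reachable_induct)
    case base
    then show ?case using assms(3) by simp
  next
    case (step y z)
    then have "y \<in> C" by (blast dest: reachable_induce_subgraph_verts)
    then have "y \<rightarrow>\<^bsub>G \<restriction> C\<^esub> z"
      using step(2) assms(1) unfolding separated_def dominates_induce_subgraph_iff by blast
    with step(3) show ?case by (rule C.reachable_adj_trans)
  qed
qed

lemma (in pair_graph) cycle_convex_Un_separatedI:
  assumes sep: "separated G C D" and C: "cycle_convex G C" and D: "cycle_convex G D"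
  shows "cycle_convex G (C \<union> D)"
proof (rule cycle_convexI)
  show "C \<union> D \<subseteq> pverts G"
    using C D unfolding cycle_convex_def by simp
  fix u x y assume u: "(u, x) \<in> parcs G" "(u, y) \<in> parcs G" "x \<noteq> y"
    and xy: "x \<rightarrow>\<^sup>*\<^bsub>G \<restriction> (C \<union> D)\<^esub> y"
  consider (left) "x \<in> C" | (right) "x \<in> D"
    using reachable_induce_subgraph_verts(1)[OF xy] by blast
  then show "u \<in> C \<union> D"
  proof cases
    case left
    then show ?thesis
      using cycle_convexD[OF C u reachable_separated[OF sep xy]] by blast
  next
    case right
    have "separated G D C" "x \<rightarrow>\<^sup>*\<^bsub>G \<restriction> (D \<union> C)\<^esub> y"
      using sep xy by (simp_all add: separated_commute Un_commute)
    then show ?thesis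
      using cycle_convexD[OF D u reachable_separated] right by blast
  qed
qed

lemma (in pair_graph) cycle_convex_separatedD:
  assumes sep: "separated G C D" and convex: "cycle_convex G (C \<union> D)"
  shows "cycle_convex G C"
proof (rule cycle_convexI)
  show "C \<subseteq> pverts G"
    using convex unfolding cycle_convex_def by simp
  fix u x y assume u: "(u, x) \<in> parcs G" "(u, y) \<in> parcs G" "x \<noteq> y" and xy: "x \<rightarrow>\<^sup>*\<^bsub>G \<restriction> C\<^esub> y"
  have "u \<in> C \<union> D"
    using cycle_convexD[OF convex u] reachable_induce_ss[OF xy] by blast
  moreover have "x \<in> C"
    using xy by (rule reachable_induce_subgraph_verts)
  ultimately show "u \<in> C"
    using sep u(1) unfolding separated_def by blast
qed

lemma (in pair_graph) cycle_convex_Un_separated_iff: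
  assumes "separated G C D"
  shows "cycle_convex G (C \<union> D) \<longleftrightarrow> cycle_convex G C \<and> cycle_convex G D"
proof
  assume CD: "cycle_convex G (C \<union> D)"
  then have "separated G D C" "cycle_convex G (D \<union> C)"
    using assms by (simp_all add: separated_commute Un_commute)
  then show "cycle_convex G C \<and> cycle_convex G D"
    using cycle_convex_separatedD[OF assms CD] cycle_convex_separatedD[of D C] by blast
qed (use assms cycle_convex_Un_separatedI in blast)

definition component :: "'a pair_pre_digraph \<Rightarrow> 'a set \<Rightarrow> 'a \<Rightarrow> 'a set" where
  "component F S x = {y. x \<rightarrow>\<^sup>*\<^bsub>F \<restriction> S\<^esub> y}"

lemma component_subset: "component F S x \<subseteq> S"
  unfolding component_def by (auto dest: reachable_induce_subgraph_verts)

lemma (in pair_graph) in_component_self: "x \<in> S \<Longrightarrow> x \<in> component G S x"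
  unfolding component_def by (simp add: wf_digraph.reachable_refl wellformed_induce_subgraph)

lemma (in pair_graph) separated_component: "separated G (component G S x) (S - component G S x)"
proof -
  interpret S: sym_digraph "G \<restriction> S" by (rule sym_digraph_induce_subgraph)
  have "z \<in> component G S x" if "y \<in> component G S x" "(y, z) \<in> parcs G" "z \<in> S" for y z
  proof -
    have "y \<rightarrow>\<^bsub>G \<restriction> S\<^esub> z"
      using that component_subset[of G S x] by (auto simp: dominates_induce_subgraph_iff)
    then show ?thesis
      using that(1) S.reachable_adj_trans unfolding component_def by blast
  qed
  then show ?thesis
    unfolding separated_def using arcs_symmetric by blast
qed

lemma (in pair_graph) cycle_convex_component:
  assumes "cycle_convex G S"
  shows "cycle_convex G (component G S x)" "cycle_convex G (S - component G S x)"
proof -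
  have "component G S x \<union> (S - component G S x) = S"
    using component_subset by fast
  then show "cycle_convex G (component G S x)" "cycle_convex G (S - component G S x)"
    using cycle_convex_Un_separated_iff[OF separated_component] assms by metis+
qed

lemma (in pair_graph) subset_cycle_hull_Int_separated:
  assumes "S \<subseteq> pverts G" and hull: "cycle_hull G S = C \<union> D" and sep: "separated G C D"
  shows "C \<subseteq> cycle_hull G (S \<inter> C)"
proof -
  have "cycle_convex G (C \<union> D)"
    using cycle_convex_cycle_hull[OF \<open>S \<subseteq> pverts G\<close>] hull by simp
  then have convex: "cycle_convex G C" "cycle_convex G D"
    using cycle_convex_Un_separated_iff[OF sep] by blast+
  let ?C' = "cycle_hull G (S \<inter> C)"
  have "?C' \<subseteq> C"
    by (rule cycle_hull_minimal[OF _ convex(1)]) simp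
  then have "separated G ?C' D"
    using sep separated_mono by blast
  moreover have "cycle_convex G ?C'"
    using \<open>S \<subseteq> pverts G\<close> by (intro cycle_convex_cycle_hull) blast
  ultimately have "cycle_convex G (?C' \<union> D)"
    using convex(2) cycle_convex_Un_separated_iff by blast
  moreover have "S \<subseteq> ?C' \<union> D"
    using subset_cycle_hull[of S G] subset_cycle_hull[of "S \<inter> C" G] hull by blast
  ultimately have "C \<union> D \<subseteq> ?C' \<union> D"
    using cycle_hull_minimal hull by metis
  then show ?thesis
    using sep unfolding separated_def by blast
qed

lemma (in pair_graph) cycle_convex_vimage:
  assumes "pair_graph G'" and hom: "\<And>x y. (x, y) \<in> parcs G \<Longrightarrow> (f x, f y) \<in> parcs G'"
    and inj: "inj_on f (pverts G)" and T: "cycle_convex G' T"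
  shows "cycle_convex G {x \<in> pverts G. f x \<in> T}" (is "cycle_convex G ?S")
proof (rule cycle_convexI)
  interpret G': pair_graph G' by fact
  interpret S: sym_digraph "G \<restriction> ?S" by (rule sym_digraph_induce_subgraph)
  interpret T: sym_digraph "G' \<restriction> T" by (rule G'.sym_digraph_induce_subgraph)
  show "?S \<subseteq> pverts G" by blast
  fix u x y assume u: "(u, x) \<in> parcs G" "(u, y) \<in> parcs G" "x \<noteq> y"
    and xy: "x \<rightarrow>\<^sup>*\<^bsub>G \<restriction> ?S\<^esub> y"
  have "f x \<rightarrow>\<^sup>*\<^bsub>G' \<restriction> T\<^esub> f y"
    using xy T.wf_digraph_axioms
    by (rule S.reachable_image)
      (auto simp: hom dominates_induce_subgraph_iff intro: T.reachable_adjI)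
  moreover have "f x \<noteq> f y"
    using u inj in_arcsD2 by (auto dest: inj_onD)
  ultimately have "f u \<in> T"
    using G'.cycle_convexD[OF T hom[OF u(1)] hom[OF u(2)]] by blast
  then show "u \<in> ?S"
    using u(1) in_arcsD1 by blast
qed

lemma (in pair_graph) cycle_hull_image_subset:
  assumes "pair_graph G'" and "\<And>x y. (x, y) \<in> parcs G \<Longrightarrow> (f x, f y) \<in> parcs G'"
    and "inj_on f (pverts G)" and S: "S \<subseteq> pverts G" "f ` S \<subseteq> pverts G'"
  shows "f ` cycle_hull G S \<subseteq> cycle_hull G' (f ` S)"
proof -
  have "cycle_convex G {x \<in> pverts G. f x \<in> cycle_hull G' (f ` S)}"
    by (rule cycle_convex_vimage[OF assms(1-3) cycle_convex_cycle_hull[OF S(2)]])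
  moreover have "S \<subseteq> {x \<in> pverts G. f x \<in> cycle_hull G' (f ` S)}"
    using S(1) subset_cycle_hull[of "f ` S" G'] by blast
  ultimately show ?thesis
    using cycle_hull_minimal by blast
qed

section \<open>Caratheodory witnesses\<close>

definition caratheodory_witness :: "'a pair_pre_digraph \<Rightarrow> 'a set \<Rightarrow> 'a \<Rightarrow> bool" where
  "caratheodory_witness F S p \<longleftrightarrow>
     S \<subseteq> pverts F \<and> p \<in> cycle_hull F S \<and> (\<forall>a\<in>S. p \<notin> cycle_hull F (S - {a}))"

lemma caratheodory_independent_iff_witness:
  "caratheodory_independent F S \<longleftrightarrow> (\<exists>p. caratheodory_witness F S p)"
  unfolding caratheodory_independent_def caratheodory_witness_def by blast

lemma caratheodory_witness_not_in_hull_Diff: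
  assumes "caratheodory_witness F S p" and "x \<in> S"
  shows "x \<notin> cycle_hull F (S - {x})"
proof
  assume "x \<in> cycle_hull F (S - {x})"
  then have "S \<subseteq> cycle_hull F (S - {x})"
    using subset_cycle_hull[of "S - {x}" F] by blast
  moreover have "cycle_convex F (cycle_hull F (S - {x}))"
    using assms(1) unfolding caratheodory_witness_def by (intro cycle_convex_cycle_hull) blast
  ultimately have "cycle_hull F S \<subseteq> cycle_hull F (S - {x})"
    by (rule cycle_hull_minimal)
  then show False
    using assms unfolding caratheodory_witness_def by blast
qed

text \<open>An element of \<open>S\<close> outside the component of \<open>p\<close> in the hull would not contribute to \<open>p\<close>.\<close>

lemma (in pair_graph) strongly_connected_hull_if_witness:
  assumes witness: "caratheodory_witness G S p"
  shows "strongly_connected (G \<restriction> cycle_hull G S)"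
proof -
  let ?A = "cycle_hull G S" and ?C = "component G (cycle_hull G S) p"
  have S: "S \<subseteq> pverts G" and p: "p \<in> ?A"
    and nonredundant: "\<And>a. a \<in> S \<Longrightarrow> p \<notin> cycle_hull G (S - {a})"
    using witness unfolding caratheodory_witness_def by blast+
  have "?A = ?C \<union> (?A - ?C)"
    using component_subset by fast
  then have "p \<in> cycle_hull G (S \<inter> ?C)"
    using subset_cycle_hull_Int_separated[OF S _ separated_component] in_component_self[OF p] by blast
  moreover have "cycle_hull G (S \<inter> ?C) \<subseteq> cycle_hull G (S - {a})" if "a \<in> S - ?C" for a
    using that by (intro cycle_hull_mono) blast
  ultimately have "S \<subseteq> ?C"
    using nonredundant by blast
  then have "?A \<subseteq> ?C"
    by (rule cycle_hull_minimal) (rule cycle_convex_component(1)[OF cycle_convex_cycle_hull[OF S]])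
  then have "p \<rightarrow>\<^sup>*\<^bsub>G \<restriction> ?A\<^esub> x" if "x \<in> ?A" for x
    using that unfolding component_def by blast
  with p show ?thesis
    using sym_digraph.strongly_connectedI_reachable_from[OF sym_digraph_induce_subgraph] by simp
qed

section \<open>Cartesian products\<close>

lemma pverts_cartesian_product [simp]: "pverts (G \<box> H) = pverts G \<times> pverts H"
  by (simp add: cartesian_product_def)

lemma parcs_cartesian_product_iff:
  "((g, h), (g', h')) \<in> parcs (G \<box> H) \<longleftrightarrow>
     (g, g') \<in> parcs G \<and> h = h' \<and> h \<in> pverts H \<or> g = g' \<and> g \<in> pverts G \<and> (h, h') \<in> parcs H"
  by (simp add: cartesian_product_def)

lemma separated_Times:
  "separated G C D \<Longrightarrow> separated (G \<box> H) (C \<times> B) (D \<times> B')"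
  unfolding separated_def by (auto simp: parcs_cartesian_product_iff)

lemma separated_Times_disjoint:
  "A \<inter> A' = {} \<Longrightarrow> B \<inter> B' = {} \<Longrightarrow> separated (G \<box> H) (A \<times> B) (A' \<times> B')"
  unfolding separated_def by (auto simp: parcs_cartesian_product_iff)

locale pair_graph_product = G: pair_graph G + H: pair_graph H
  for G :: "'a pair_pre_digraph" and H :: "'b pair_pre_digraph"

sublocale pair_graph_product \<subseteq> GH: pair_graph "G \<box> H"
proof
  have "parcs (G \<box> H) \<subseteq> (pverts G \<times> pverts H) \<times> (pverts G \<times> pverts H)"
    by (auto simp: parcs_cartesian_product_iff dest: G.wellformed' H.wellformed')
  then show "finite (parcs (G \<box> H))"
    using G.pair_finite_verts H.pair_finite_verts by (auto intro: finite_subset)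
  show "finite (pverts (G \<box> H))"
    using G.pair_finite_verts H.pair_finite_verts by simp
  show "symmetric (G \<box> H)"
    by (auto simp: symmetric_def sym_def parcs_cartesian_product_iff
        dest: G.arcs_symmetric H.arcs_symmetric)
  fix e assume "e \<in> parcs (G \<box> H)"
  then show "fst e \<in> pverts (G \<box> H)" "snd e \<in> pverts (G \<box> H)" "fst e \<noteq> snd e"
    by (cases e; auto simp: parcs_cartesian_product_iff
        dest: G.wellformed' H.wellformed' G.no_loops' H.no_loops')+
qed

context pair_graph_product
begin

lemma cycle_convex_Times:
  assumes A: "cycle_convex G A" and B: "cycle_convex H B"
  shows "cycle_convex (G \<box> H) (A \<times> B)"
proof (rule GH.cycle_convexI)
  show "A \<times> B \<subseteq> pverts (G \<box> H)"
    using A B unfolding cycle_convex_def by auto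
  interpret AB: sym_digraph "(G \<box> H) \<restriction> (A \<times> B)" by (rule GH.sym_digraph_induce_subgraph)
  interpret A: sym_digraph "G \<restriction> A" by (rule G.sym_digraph_induce_subgraph)
  interpret B: sym_digraph "H \<restriction> B" by (rule H.sym_digraph_induce_subgraph)
  fix u x y
  assume u: "(u, x) \<in> parcs (G \<box> H)" "(u, y) \<in> parcs (G \<box> H)" "x \<noteq> y"
    and xy: "x \<rightarrow>\<^sup>*\<^bsub>(G \<box> H) \<restriction> (A \<times> B)\<^esub> y"
  have reach_fst: "fst x \<rightarrow>\<^sup>*\<^bsub>G \<restriction> A\<^esub> fst y"
    using xy A.wf_digraph_axioms
    by (rule AB.reachable_image)
      (auto simp: dominates_induce_subgraph_iff parcs_cartesian_product_iff intro: A.reachable_adjI)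
  have reach_snd: "snd x \<rightarrow>\<^sup>*\<^bsub>H \<restriction> B\<^esub> snd y"
    using xy B.wf_digraph_axioms
    by (rule AB.reachable_image)
      (auto simp: dominates_induce_subgraph_iff parcs_cartesian_product_iff intro: B.reachable_adjI)
  obtain g h g1 h1 g2 h2 where coords: "u = (g, h)" "x = (g1, h1)" "y = (g2, h2)"
    by (cases u, cases x, cases y)
  have "g1 \<in> A" "h1 \<in> B" "g2 \<in> A" "h2 \<in> B"
    using reachable_induce_subgraph_verts[OF xy] unfolding coords by auto
  moreover have "g \<in> A" if "h1 = h" "h2 = h" "(g, g1) \<in> parcs G" "(g, g2) \<in> parcs G"
    using G.cycle_convexD[OF A that(3,4)] reach_fst u(3) that unfolding coords by simp
  moreover have "h \<in> B" if "g1 = g" "g2 = g" "(h, h1) \<in> parcs H" "(h, h2) \<in> parcs H"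
    using H.cycle_convexD[OF B that(3,4)] reach_snd u(3) that unfolding coords by simp
  ultimately show "u \<in> A \<times> B"
    using u(1,2) unfolding coords parcs_cartesian_product_iff by auto
qed

lemma cycle_convex_square_closed:
  assumes T: "cycle_convex (G \<box> H) T" and arcs: "(g, g') \<in> parcs G" "(h, h') \<in> parcs H"
    and corners: "(g, h) \<in> T" "(g', h) \<in> T" "(g, h') \<in> T"
  shows "(g', h') \<in> T"
proof -
  interpret T: sym_digraph "(G \<box> H) \<restriction> T" by (rule GH.sym_digraph_induce_subgraph)
  note in_verts = G.wellformed'[OF arcs(1)] H.wellformed'[OF arcs(2)]
  note sym = G.arcs_symmetric[OF arcs(1)] H.arcs_symmetric[OF arcs(2)]
  have "(g', h) \<rightarrow>\<^bsub>(G \<box> H) \<restriction> T\<^esub> (g, h)" "(g, h) \<rightarrow>\<^bsub>(G \<box> H) \<restriction> T\<^esub> (g, h')"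
    using arcs sym in_verts corners
    by (simp_all add: dominates_induce_subgraph_iff parcs_cartesian_product_iff)
  then have "(g', h) \<rightarrow>\<^sup>*\<^bsub>(G \<box> H) \<restriction> T\<^esub> (g, h')"
    using T.reachable_adjI T.reachable_trans by blast
  moreover have "(g', h) \<noteq> (g, h')"
    using arcs(1) G.no_loops' by blast
  ultimately show ?thesis
    using sym in_verts by (intro GH.cycle_convexD[OF T]) (auto simp: parcs_cartesian_product_iff)
qed

lemma Times_subset_cycle_convex:
  assumes T: "cycle_convex (G \<box> H) T"
    and A: "strongly_connected (G \<restriction> A)" "x \<in> A" "A \<times> {y} \<subseteq> T"
    and B: "strongly_connected (H \<restriction> B)" "y \<in> B" "{x} \<times> B \<subseteq> T"
  shows "A \<times> B \<subseteq> T"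
proof -
  interpret A: sym_digraph "G \<restriction> A" by (rule G.sym_digraph_induce_subgraph)
  interpret B: sym_digraph "H \<restriction> B" by (rule H.sym_digraph_induce_subgraph)
  have column: "{g'} \<times> B \<subseteq> T" if g: "(g, g') \<in> parcs G" "g' \<in> A" and column_g: "{g} \<times> B \<subseteq> T" for g g'
  proof -
    have "(g', h) \<in> T" if "y \<rightarrow>\<^sup>*\<^bsub>H \<restriction> B\<^esub> h" for h
      using that
    proof (induct rule: B.reachable_induct)
      case base
      then show ?case using A(3) g(2) by blast
    next
      case (step h h')
      then have h: "(h, h') \<in> parcs H" "h \<in> B" "h' \<in> B"
        unfolding dominates_induce_subgraph_iff by blast+
      then show ?case
        using cycle_convex_square_closed[OF T g(1) h(1)] step(3) column_g by blast
    qed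
    then show ?thesis
      using B(1,2) by auto
  qed
  have "{g} \<times> B \<subseteq> T" if "x \<rightarrow>\<^sup>*\<^bsub>G \<restriction> A\<^esub> g" for g
    using that
  proof (induct rule: A.reachable_induct)
    case base
    show ?case by (rule B(3))
  next
    case (step g g')
    then show ?case using column unfolding dominates_induce_subgraph_iff by blast
  qed
  moreover have "x \<rightarrow>\<^sup>*\<^bsub>G \<restriction> A\<^esub> g" if "g \<in> A" for g
    using A(1,2) that by auto
  ultimately show ?thesis by blast
qed

end

section \<open>Crosses\<close>

text \<open>
  The share of one factor in the cross construction: \<open>X\<close> is crossed at \<open>x\<close>, and \<open>p\<close> is the
  coordinate of the witness. The last conjunct does not require \<open>p \<notin> cycle_hull F (X - {a})\<close>, which
  fails for a convex induced path.
\<close>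

definition cross_arm :: "'a pair_pre_digraph \<Rightarrow> 'a set \<Rightarrow> 'a \<Rightarrow> 'a \<Rightarrow> bool" where
  "cross_arm F X x p \<longleftrightarrow>
     X \<subseteq> pverts F \<and> x \<in> X \<and> p \<in> cycle_hull F X \<and> p \<noteq> x \<and>
     strongly_connected (F \<restriction> cycle_hull F X) \<and>
     x \<notin> cycle_hull F (X - {x}) \<and>
     (\<forall>a \<in> X - {x}. p \<notin> component F (cycle_hull F (X - {a})) x)"

definition cross :: "'a set \<Rightarrow> 'a \<Rightarrow> 'b set \<Rightarrow> 'b \<Rightarrow> ('a \<times> 'b) set" where
  "cross X x Y y = X \<times> {y} \<union> {x} \<times> Y"

lemma card_cross:
  assumes "finite X" "finite Y" "x \<in> X" "y \<in> Y"
  shows "card (cross X x Y y) = card X + card Y - 1"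
proof -
  have "X \<times> {y} \<inter> {x} \<times> Y = {(x, y)}"
    using assms by blast
  then show ?thesis
    using card_Un_Int[of "X \<times> {y}" "{x} \<times> Y"] assms
    unfolding cross_def by (simp add: card_cartesian_product)
qed

lemma image_swap_cross: "prod.swap ` cross X x Y y = cross Y y X x"
  unfolding cross_def by force

context pair_graph_product
begin

lemma Times_hull_subset_hull_cross:
  assumes X: "cross_arm G X x p" and Y: "cross_arm H Y y q"
  shows "cycle_hull G X \<times> cycle_hull H Y \<subseteq> cycle_hull (G \<box> H) (cross X x Y y)"
proof (rule Times_subset_cycle_convex)
  have verts: "X \<subseteq> pverts G" "Y \<subseteq> pverts H" and xy: "x \<in> X" "y \<in> Y"
    using X Y unfolding cross_arm_def by blast+
  then have cross: "cross X x Y y \<subseteq> pverts (G \<box> H)"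
    unfolding cross_def by auto
  then show "cycle_convex (G \<box> H) (cycle_hull (G \<box> H) (cross X x Y y))"
    by (rule cycle_convex_cycle_hull)
  show "strongly_connected (G \<restriction> cycle_hull G X)" "strongly_connected (H \<restriction> cycle_hull H Y)"
    using X Y unfolding cross_arm_def by blast+
  show "x \<in> cycle_hull G X" "y \<in> cycle_hull H Y"
    using xy subset_cycle_hull by fast+
  have "(\<lambda>g. (g, y)) ` cycle_hull G X \<subseteq> cycle_hull (G \<box> H) ((\<lambda>g. (g, y)) ` X)"
    using verts xy
    by (intro G.cycle_hull_image_subset GH.pair_graph)
      (auto simp: parcs_cartesian_product_iff inj_on_def)
  also have "\<dots> \<subseteq> cycle_hull (G \<box> H) (cross X x Y y)"
    unfolding cross_def by (rule cycle_hull_mono) blast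
  finally show "cycle_hull G X \<times> {y} \<subseteq> cycle_hull (G \<box> H) (cross X x Y y)"
    by blast
  have "Pair x ` cycle_hull H Y \<subseteq> cycle_hull (G \<box> H) (Pair x ` Y)"
    using verts xy
    by (intro H.cycle_hull_image_subset GH.pair_graph)
      (auto simp: parcs_cartesian_product_iff inj_on_def)
  also have "\<dots> \<subseteq> cycle_hull (G \<box> H) (cross X x Y y)"
    unfolding cross_def by (rule cycle_hull_mono) blast
  finally show "{x} \<times> cycle_hull H Y \<subseteq> cycle_hull (G \<box> H) (cross X x Y y)"
    by blast
qed

lemma tip_notin_hull_cross_Diff_centre:
  assumes X: "cross_arm G X x p" and Y: "cross_arm H Y y q"
  shows "(p, q) \<notin> cycle_hull (G \<box> H) (cross X x Y y - {(x, y)})"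
proof -
  let ?Z = "cycle_hull G (X - {x})" and ?W = "cycle_hull H (Y - {y})"
  have verts: "X \<subseteq> pverts G" "Y \<subseteq> pverts H" and xy: "x \<in> X" "y \<in> Y" "x \<notin> ?Z" "y \<notin> ?W"
    and tips: "p \<noteq> x" "q \<noteq> y"
    using X Y unfolding cross_arm_def by blast+
  have "separated (G \<box> H) (?Z \<times> {y}) ({x} \<times> ?W)"
    using xy by (intro separated_Times_disjoint) auto
  moreover have "cycle_convex (G \<box> H) (?Z \<times> {y})" "cycle_convex (G \<box> H) ({x} \<times> ?W)"
    using verts xy
    by (blast intro: cycle_convex_Times cycle_convex_cycle_hull
        G.cycle_convex_singleton H.cycle_convex_singleton)+
  ultimately have "cycle_convex (G \<box> H) (?Z \<times> {y} \<union> {x} \<times> ?W)"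
    using GH.cycle_convex_Un_separatedI by blast
  moreover have "cross X x Y y - {(x, y)} \<subseteq> ?Z \<times> {y} \<union> {x} \<times> ?W"
    using subset_cycle_hull[of "X - {x}" G] subset_cycle_hull[of "Y - {y}" H]
    unfolding cross_def by blast
  ultimately have "cycle_hull (G \<box> H) (cross X x Y y - {(x, y)}) \<subseteq> ?Z \<times> {y} \<union> {x} \<times> ?W"
    by (intro cycle_hull_minimal)
  then show ?thesis
    using tips by blast
qed

lemma tip_notin_hull_cross_Diff_fst:
  assumes X: "cross_arm G X x p" and Y: "cross_arm H Y y q" and a: "a \<in> X - {x}"
  shows "(p, q) \<notin> cycle_hull (G \<box> H) (cross X x Y y - {(a, y)})"
proof -
  let ?Z = "cycle_hull G (X - {a})" and ?B = "cycle_hull H Y"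
  let ?C = "component G ?Z x"
  have verts: "X - {a} \<subseteq> pverts G" "Y \<subseteq> pverts H" and xy: "x \<in> X" "y \<in> Y"
    and tips: "p \<notin> ?C" "q \<noteq> y"
    using X Y a unfolding cross_arm_def by blast+
  have "cycle_convex G ?C" "cycle_convex G (?Z - ?C)"
    using cycle_convex_cycle_hull[OF verts(1)] by (rule G.cycle_convex_component)+
  then have "cycle_convex (G \<box> H) (?C \<times> ?B)" "cycle_convex (G \<box> H) ((?Z - ?C) \<times> {y})"
    using verts xy
    by (blast intro: cycle_convex_Times cycle_convex_cycle_hull H.cycle_convex_singleton)+
  then have "cycle_convex (G \<box> H) (?C \<times> ?B \<union> (?Z - ?C) \<times> {y})"
    by (rule GH.cycle_convex_Un_separatedI[OF separated_Times[OF G.separated_component]])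
  moreover have "x \<in> ?Z"
    using xy a subset_cycle_hull[of "X - {a}" G] by blast
  then have "x \<in> ?C"
    by (rule G.in_component_self)
  then have "cross X x Y y - {(a, y)} \<subseteq> ?C \<times> ?B \<union> (?Z - ?C) \<times> {y}"
    using xy subset_cycle_hull[of "X - {a}" G] subset_cycle_hull[of Y H] unfolding cross_def by blast
  ultimately have "cycle_hull (G \<box> H) (cross X x Y y - {(a, y)}) \<subseteq> ?C \<times> ?B \<union> (?Z - ?C) \<times> {y}"
    by (intro cycle_hull_minimal)
  then show ?thesis
    using tips by blast
qed

lemma tip_notin_hull_cross_Diff_snd:
  assumes X: "cross_arm G X x p" and Y: "cross_arm H Y y q" and b: "b \<in> Y - {y}"
  shows "(p, q) \<notin> cycle_hull (G \<box> H) (cross X x Y y - {(x, b)})"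
proof
  interpret HG: pair_graph_product H G ..
  let ?S = "cross X x Y y - {(x, b)}"
  have "?S \<subseteq> pverts (G \<box> H)"
    using X Y unfolding cross_arm_def cross_def by auto
  then have "prod.swap ` cycle_hull (G \<box> H) ?S \<subseteq> cycle_hull (H \<box> G) (prod.swap ` ?S)"
    by (intro GH.cycle_hull_image_subset HG.GH.pair_graph)
      (auto simp: parcs_cartesian_product_iff)
  moreover have "prod.swap ` ?S = cross Y y X x - {(b, x)}"
    by (simp add: image_set_diff image_swap_cross)
  moreover assume "(p, q) \<in> cycle_hull (G \<box> H) ?S"
  ultimately have "(q, p) \<in> cycle_hull (H \<box> G) (cross Y y X x - {(b, x)})"
    by force
  then show False
    using HG.tip_notin_hull_cross_Diff_fst[OF Y X b] by blast
qed

lemma caratheodory_witness_cross: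
  assumes X: "cross_arm G X x p" and Y: "cross_arm H Y y q"
  shows "caratheodory_witness (G \<box> H) (cross X x Y y) (p, q)"
  unfolding caratheodory_witness_def
proof (intro conjI ballI)
  show "cross X x Y y \<subseteq> pverts (G \<box> H)"
    using X Y unfolding cross_arm_def cross_def by auto
  show "(p, q) \<in> cycle_hull (G \<box> H) (cross X x Y y)"
    using Times_hull_subset_hull_cross[OF X Y] X Y unfolding cross_arm_def by blast
  fix e assume "e \<in> cross X x Y y"
  then consider "e = (x, y)" | a where "e = (a, y)" "a \<in> X - {x}"
    | b where "e = (x, b)" "b \<in> Y - {y}"
    unfolding cross_def by blast
  then show "(p, q) \<notin> cycle_hull (G \<box> H) (cross X x Y y - {e})"
    using tip_notin_hull_cross_Diff_centre[OF X Y] tip_notin_hull_cross_Diff_fst[OF X Y]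
      tip_notin_hull_cross_Diff_snd[OF X Y] by cases blast+
qed

end

section \<open>Convex induced paths\<close>

definition induced_path :: "'a pair_pre_digraph \<Rightarrow> 'a list \<Rightarrow> bool" where
  "induced_path F xs \<longleftrightarrow> vpath xs (with_proj F) \<and>
     parcs F \<inter> set xs \<times> set xs = set (vwalk_arcs xs) \<union> (set (vwalk_arcs xs))\<inverse>"

lemma card_induced_path: "induced_path F xs \<Longrightarrow> card (set xs) = length xs"
  by (simp add: induced_path_def vpath_def distinct_card)

lemma vwalk_arcs_pawalk_verts: "pcas u p v \<Longrightarrow> vwalk_arcs (pawalk_verts u p) = p"
proof (induct p arbitrary: u)
  case (Cons e p)
  then show ?case by (cases p) auto
qed simp

lemma pawalk_verts_vwalk_arcs: "xs \<noteq> [] \<Longrightarrow> pawalk_verts (hd xs) (vwalk_arcs xs) = xs"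
  by (induct xs rule: vwalk_arcs.induct) auto

lemma pcas_vwalk_arcs: "xs \<noteq> [] \<Longrightarrow> pcas (hd xs) (vwalk_arcs xs) (last xs)"
  by (induct xs rule: vwalk_arcs.induct) auto

lemma (in pair_graph) induced_path_verts_iff:
  "induced_path_verts G X \<longleftrightarrow> (\<exists>xs. induced_path G xs \<and> set xs = X)"
proof
  assume "induced_path_verts G X"
  then obtain u p v where p: "apath u p v" and X: "X = set (pawalk_verts u p)"
    and arcs: "parcs G \<inter> X \<times> X = set p \<union> (set p)\<inverse>"
    unfolding induced_path_verts_def awalk_verts_with_proj_eq arcs_induce_subgraph_with_proj
    by blast
  have "vpath (pawalk_verts u p) G"
    using p awalk_imp_vwalk unfolding apath_def by auto
  moreover have "vwalk_arcs (pawalk_verts u p) = p"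
    using p vwalk_arcs_pawalk_verts[of u p v] by (simp add: apath_def awalk_def)
  ultimately have "induced_path G (pawalk_verts u p)"
    using arcs unfolding induced_path_def X by simp
  then show "\<exists>xs. induced_path G xs \<and> set xs = X"
    using X by blast
next
  assume "\<exists>xs. induced_path G xs \<and> set xs = X"
  then obtain xs where xs: "induced_path G xs" "set xs = X" by blast
  then have path: "vpath xs G" and ne: "xs \<noteq> []"
    unfolding induced_path_def by auto
  then have "apath (hd xs) (vwalk_arcs xs) (last xs)"
    by (auto simp: apath_def awalk_def vpath_def vwalk_def pawalk_verts_vwalk_arcs
        pcas_vwalk_arcs intro: hd_in_set[THEN subsetD[rotated]])
  moreover have "arcs (G \<restriction> X) = set (vwalk_arcs xs) \<union> (set (vwalk_arcs xs))\<inverse>"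
    using xs unfolding induced_path_def arcs_induce_subgraph_with_proj by blast
  ultimately show "induced_path_verts G X"
    unfolding induced_path_verts_def using ne xs(2)
    by (metis awalk_verts_with_proj_eq pawalk_verts_vwalk_arcs)
qed

lemma induced_path_crossing_arc:
  assumes "induced_path F (ys @ zs)" and "y \<in> set ys" "z \<in> set zs"
    and "(y, z) \<in> parcs F \<or> (z, y) \<in> parcs F"
  shows "y = last ys" "z = hd zs"
proof -
  have ne: "ys \<noteq> []" "zs \<noteq> []" and disjoint: "set ys \<inter> set zs = {}"
    using assms unfolding induced_path_def vpath_def by auto
  have "(y, z) \<in> set (vwalk_arcs (ys @ zs)) \<union> (set (vwalk_arcs (ys @ zs)))\<inverse> \<or>
      (z, y) \<in> set (vwalk_arcs (ys @ zs)) \<union> (set (vwalk_arcs (ys @ zs)))\<inverse>"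
    using assms unfolding induced_path_def by (metis IntI SigmaI Un_iff set_append)
  then have "(y, z) = (last ys, hd zs) \<or> (z, y) = (last ys, hd zs)"
    using ne disjoint assms(2,3) by (auto simp: vwalk_arcs_append elim!: in_set_vwalk_arcsE)
  then show "y = last ys" "z = hd zs"
    using ne disjoint assms(2,3) by auto
qed

lemma induced_path_separated:
  assumes path: "induced_path F (ys @ a # zs)"
  shows "separated F (set ys) (set zs)"
proof -
  have distinct: "distinct (ys @ a # zs)"
    using path unfolding induced_path_def vpath_def by blast
  have "\<not> ((y, z) \<in> parcs F \<or> (z, y) \<in> parcs F)" if "y \<in> set ys" "z \<in> set zs" for y z
    using induced_path_crossing_arc(2)[OF path, of y z] distinct that by auto
  then show ?thesis
    unfolding separated_def using distinct by auto
qed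

lemma (in pair_graph) induced_path_acyclic:
  assumes path: "induced_path G xs" and u: "u \<in> set xs"
  shows "\<not> cycle_through (G \<restriction> set xs) u"
proof
  from u obtain ys zs where xs: "xs = ys @ u # zs" by (auto dest: split_list)
  have sep: "separated G (set ys) (set zs)"
    using path unfolding xs by (rule induced_path_separated)
  then have sep': "separated G (set zs) (set ys)"
    by (simp add: separated_commute)
  assume "cycle_through (G \<restriction> set xs) u"
  then have "cycle_through (G \<restriction> insert u (set ys \<union> set zs)) u"
    unfolding xs by simp
  then obtain x y where nbrs: "(u, x) \<in> parcs G" "(u, y) \<in> parcs G" "x \<noteq> y"
    and xy: "x \<rightarrow>\<^sup>*\<^bsub>G \<restriction> (set ys \<union> set zs)\<^esub> y"
    by (rule cycle_through_insertD)
  have "x \<in> set ys \<union> set zs"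
    using xy by (rule reachable_induce_subgraph_verts)
  then consider (before) "x \<in> set ys" "y \<in> set ys" | (after) "x \<in> set zs" "y \<in> set zs"
    using reachable_separated[OF sep xy] reachable_separated[OF sep', of x y] xy
      reachable_induce_subgraph_verts(2) by (metis Un_iff sup_commute)
  then show False
  proof cases
    case before
    moreover have "induced_path G (ys @ u # zs)"
      using path unfolding xs .
    ultimately show False
      using nbrs induced_path_crossing_arc(1) by (metis list.set_intros(1))
  next
    case after
    moreover have "induced_path G ((ys @ [u]) @ zs)"
      using path unfolding xs by simp
    moreover have "u \<in> set (ys @ [u])" by simp
    ultimately show False
      using nbrs induced_path_crossing_arc(2) by metis
  qed
qed

lemma cycle_convex_subset_acyclic:
  assumes convex: "cycle_convex F S" and acyclic: "\<And>u. u \<in> S \<Longrightarrow> \<not> cycle_through (F \<restriction> S) u"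
    and "X \<subseteq> S"
  shows "cycle_convex F X"
  unfolding cycle_convex_def
proof (intro conjI ballI notI)
  show "X \<subseteq> pverts F"
    using convex \<open>X \<subseteq> S\<close> unfolding cycle_convex_def by blast
  fix u assume "u \<in> pverts F - X" and "cycle_through (F \<restriction> (X \<union> {u})) u"
  from this(2) have "cycle_through (F \<restriction> (S \<union> {u})) u"
    by (rule cycle_through_mono) (use \<open>X \<subseteq> S\<close> in blast)
  then show False
    using convex acyclic \<open>u \<in> pverts F - X\<close> unfolding cycle_convex_def
    by (cases "u \<in> S") (auto simp: insert_absorb)
qed

lemma (in pair_graph) strongly_connected_induced_path:
  assumes "induced_path G xs"
  shows "strongly_connected (G \<restriction> set xs)"
proof (rule sym_digraph.strongly_connected_if_spanning_vwalk[OF sym_digraph_induce_subgraph])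
  have "xs \<noteq> []" "set (vwalk_arcs xs) \<subseteq> parcs G"
    using assms by (auto simp: induced_path_def vpath_def vwalk_def)
  then show "vwalk xs (G \<restriction> set xs)"
    using arcs_in_vwalk_arcs[of _ xs] unfolding vwalk_def
    by (auto simp: dominates_induce_subgraph_iff)
qed simp

lemma (in pair_graph) induced_path_Diff_separates_ends:
  assumes path: "induced_path G xs" and a: "a \<in> set xs - {hd xs}"
  shows "last xs \<notin> component G (set xs - {a}) (hd xs)"
proof
  assume "last xs \<in> component G (set xs - {a}) (hd xs)"
  then have reach: "hd xs \<rightarrow>\<^sup>*\<^bsub>G \<restriction> (set xs - {a})\<^esub> last xs"
    unfolding component_def by simp
  have "distinct xs"
    using path unfolding induced_path_def by auto
  obtain ys zs where xs: "xs = ys @ a # zs"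
    using a by (auto dest: split_list)
  have "hd xs \<in> set ys"
    using a unfolding xs by (cases ys) auto
  moreover have "set xs - {a} = set ys \<union> set zs"
    using \<open>distinct xs\<close> unfolding xs by auto
  ultimately have "last xs \<in> set ys"
    using reachable_separated[OF induced_path_separated[OF path[unfolded xs]]] reach
      reachable_induce_subgraph_verts(2) by metis
  then show False
    using \<open>distinct xs\<close> unfolding xs by (cases zs rule: rev_cases) auto
qed

lemma (in pair_graph) cross_arm_induced_path:
  assumes path: "induced_path G xs" and convex: "cycle_convex G (set xs)" and "2 \<le> length xs"
  shows "cross_arm G (set xs) (hd xs) (last xs)"
proof -
  have "xs \<noteq> []" and "distinct xs"
    using path unfolding induced_path_def by auto
  then have "last xs \<noteq> hd xs"
    using \<open>2 \<le> length xs\<close> by (cases xs) auto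
  moreover have "cycle_hull G X = X" if "X \<subseteq> set xs" for X
    using cycle_convex_subset_acyclic[OF convex induced_path_acyclic[OF path] that]
    by (rule cycle_hull_eq)
  ultimately show ?thesis
    using convex \<open>xs \<noteq> []\<close> strongly_connected_induced_path[OF path]
      induced_path_Diff_separates_ends[OF path]
    unfolding cross_arm_def by (auto simp: cycle_convex_def)
qed

section \<open>Large cross arms in connected graphs\<close>

lemma (in pair_graph) cross_arm_witness:
  assumes witness: "caratheodory_witness G S p" and x: "x \<in> S" "x \<noteq> p"
  shows "cross_arm G S x p"
proof -
  have "x \<notin> cycle_hull G (S - {x})"
    using caratheodory_witness_not_in_hull_Diff[OF witness x(1)] .
  moreover have "p \<notin> component G (cycle_hull G (S - {a})) x" if "a \<in> S" for a
    using witness that component_subset unfolding caratheodory_witness_def by fast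
  ultimately show ?thesis
    using witness x strongly_connected_hull_if_witness[OF witness]
    unfolding cross_arm_def caratheodory_witness_def by blast
qed

lemma (in pair_graph) cycle_convex_edge_if_no_common_neighbour:
  assumes "(x, y) \<in> parcs G" and "\<And>z. \<not> ((x, z) \<in> parcs G \<and> (y, z) \<in> parcs G)"
  shows "cycle_convex G {x, y}"
proof (rule cycle_convexI)
  show "{x, y} \<subseteq> pverts G"
    using assms(1) wellformed' by auto
  fix u a b assume u: "(u, a) \<in> parcs G" "(u, b) \<in> parcs G" "a \<noteq> b"
    and ab: "a \<rightarrow>\<^sup>*\<^bsub>G \<restriction> {x, y}\<^esub> b"
  have "a \<in> {x, y}" "b \<in> {x, y}"
    using ab by (rule reachable_induce_subgraph_verts)+
  then show "u \<in> {x, y}"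
    using u assms(2)[of u] arcs_symmetric by blast
qed

lemma (in pair_graph) caratheodory_witness_triangle:
  assumes "(x, y) \<in> parcs G" "(x, z) \<in> parcs G" "(y, z) \<in> parcs G"
  shows "caratheodory_witness G {x, y} z"
  unfolding caratheodory_witness_def
proof (intro conjI ballI)
  have distinct: "x \<noteq> y" "x \<noteq> z" "y \<noteq> z"
    using assms no_loops' by blast+
  show verts: "{x, y} \<subseteq> pverts G"
    using assms(1) wellformed' by auto
  interpret hull: sym_digraph "G \<restriction> cycle_hull G {x, y}" by (rule sym_digraph_induce_subgraph)
  have "x \<rightarrow>\<^bsub>G \<restriction> cycle_hull G {x, y}\<^esub> y"
    using assms(1) subset_cycle_hull[of "{x, y}" G] by (simp add: dominates_induce_subgraph_iff)
  then show "z \<in> cycle_hull G {x, y}"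
    using cycle_convexD[OF cycle_convex_cycle_hull[OF verts]] assms(2,3) distinct(1)
      arcs_symmetric hull.reachable_adjI by blast
  fix a assume "a \<in> {x, y}"
  then obtain v where v: "v \<in> {x, y}" "{x, y} - {a} = {v}"
    using distinct(1) by blast
  then have "cycle_hull G {v} = {v}"
    using verts by (intro cycle_hull_eq cycle_convex_singleton) blast
  then show "z \<notin> cycle_hull G ({x, y} - {a})"
    using distinct v by auto
qed

lemma finite_card_Collect:
  assumes "finite V" and "\<And>S. P S \<Longrightarrow> S \<subseteq> V"
  shows "finite {card S |S. P S}"
proof -
  have "{card S |S. P S} \<subseteq> card ` Pow V"
    using assms(2) by auto
  then show ?thesis
    using assms(1) finite_subset by blast
qed

lemma Max_card_attained:
  assumes "finite V" and "\<And>S. P S \<Longrightarrow> S \<subseteq> V" and "P S\<^sub>0"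
  shows "\<exists>S. P S \<and> card S = Max {card S |S. P S}"
proof -
  have "Max {card S |S. P S} \<in> {card S |S. P S}"
    using finite_card_Collect[OF assms(1,2)] assms(3) by (intro Max_in) auto
  then show ?thesis by auto
qed

context pair_graph
begin

lemma card_le_car:
  assumes "caratheodory_independent G S"
  shows "card S \<le> car G"
  unfolding car_def using assms pair_finite_verts
  by (intro Max_ge finite_card_Collect[where V = "pverts G"])
    (auto simp: caratheodory_independent_def)

lemma car_attained:
  assumes "pverts G \<noteq> {}"
  obtains S p where "caratheodory_witness G S p" "card S = car G"
proof -
  obtain v where "v \<in> pverts G"
    using assms by blast
  then have "caratheodory_independent G {v}"
    by (simp add: caratheodory_independent_def cycle_hull_eq cycle_convex_singleton
        cycle_convex_empty)
  then have "\<exists>S. caratheodory_independent G S \<and> card S = car G"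
    unfolding car_def by (rule Max_card_attained[OF pair_finite_verts, rotated])
      (simp add: caratheodory_independent_def)
  then show ?thesis
    using that unfolding caratheodory_independent_iff_witness by blast
qed

lemma length_le_max_convex_induced_path:
  assumes path: "induced_path G xs" and "cycle_convex G (set xs)"
  shows "length xs \<le> max_convex_induced_path G"
proof -
  have "card (set xs) \<le> max_convex_induced_path G"
    unfolding max_convex_induced_path_def using assms pair_finite_verts induced_path_verts_iff
    by (intro Max_ge finite_card_Collect[where V = "pverts G"]) (auto simp: cycle_convex_def)
  then show ?thesis
    using path by (simp add: card_induced_path)
qed

lemma max_convex_induced_path_attained:
  assumes "pverts G \<noteq> {}"
  obtains xs where "induced_path G xs" "cycle_convex G (set xs)"
    "length xs = max_convex_induced_path G"
proof -
  obtain v where "v \<in> pverts G"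
    using assms by blast
  then have "induced_path G [v]"
    using no_loops' by (auto simp: induced_path_def intro: vpath_self)
  then have "induced_path_verts G {v} \<and> cycle_convex G {v}"
    using \<open>v \<in> pverts G\<close> cycle_convex_singleton induced_path_verts_iff by fastforce
  then have "\<exists>X. (induced_path_verts G X \<and> cycle_convex G X) \<and> card X = max_convex_induced_path G"
    unfolding max_convex_induced_path_def by (rule Max_card_attained[OF pair_finite_verts, rotated])
      (simp add: cycle_convex_def)
  then obtain xs where "induced_path G xs" "cycle_convex G (set xs)"
      "card (set xs) = max_convex_induced_path G"
    unfolding induced_path_verts_iff by blast
  then show ?thesis
    using that by (simp add: card_induced_path)
qed

lemma connected_obtains_arc:
  assumes conn: "Digraph_Component.connected (with_proj G)" and "2 \<le> card (pverts G)"
  obtains x y where "(x, y) \<in> parcs G"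
proof -
  obtain v w where vw: "v \<in> pverts G" "w \<in> pverts G" "v \<noteq> w"
    using assms(2) pair_finite_verts by (metis card_le_Suc0_iff_eq not_less_eq_eq numeral_2_eq_2)
  have "strongly_connected G"
    using symmetric_connected_imp_strongly_connected[OF sym_arcs conn] .
  then have "v \<rightarrow>\<^sup>*\<^bsub>G\<^esub> w"
    using vw by auto
  then show ?thesis
    using that vw(3) by (cases rule: converse_reachable_cases) auto
qed

lemma connected_obtains_cross_arm_max_convex_induced_path:
  assumes "Digraph_Component.connected (with_proj G)" "2 \<le> card (pverts G)"
  obtains X x p where "cross_arm G X x p" "max_convex_induced_path G \<le> card X"
proof (cases "2 \<le> max_convex_induced_path G")
  case True
  have "pverts G \<noteq> {}"
    using assms(2) by auto
  then obtain xs where xs: "induced_path G xs" "cycle_convex G (set xs)"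
      "length xs = max_convex_induced_path G"
    by (rule max_convex_induced_path_attained)
  then show ?thesis
    using that[OF cross_arm_induced_path[OF xs(1,2)]] card_induced_path[OF xs(1)] True by simp
next
  case False
  obtain x y where xy: "(x, y) \<in> parcs G"
    using connected_obtains_arc[OF assms] .
  then have "x \<noteq> y" by (rule no_loops')
  have "induced_path G [x, y]"
    using xy wellformed'[OF xy] no_loops' arcs_symmetric
    by (auto simp: induced_path_def vpath_def vwalk_def)
  then have "\<not> cycle_convex G {x, y}"
    using length_le_max_convex_induced_path[of "[x, y]"] False by auto
  then obtain z where z: "(x, z) \<in> parcs G" "(y, z) \<in> parcs G"
    using cycle_convex_edge_if_no_common_neighbour[OF xy] by blast
  have "cross_arm G {x, y} x z"
    using cross_arm_witness[OF caratheodory_witness_triangle[OF xy z]] z no_loops' by blast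
  then show ?thesis
    using that \<open>x \<noteq> y\<close> False by simp
qed

lemma connected_obtains_cross_arm_car:
  assumes "Digraph_Component.connected (with_proj G)" "2 \<le> card (pverts G)"
  obtains X x p where "cross_arm G X x p" "car G \<le> card X"
proof (cases "2 \<le> car G")
  case True
  have "pverts G \<noteq> {}"
    using assms(2) by auto
  then obtain S p where S: "caratheodory_witness G S p" "card S = car G"
    by (rule car_attained)
  then have "\<not> S \<subseteq> {p}"
    using True card_mono[of "{p}" S] by auto
  then obtain x where "x \<in> S" "x \<noteq> p" by blast
  then show ?thesis
    using that[OF cross_arm_witness[OF S(1)]] S(2) by simp
next
  case False
  obtain X x p where X: "cross_arm G X x p"
    using connected_obtains_cross_arm_max_convex_induced_path[OF assms] .
  then have "finite X" "X \<noteq> {}"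
    unfolding cross_arm_def using pair_finite_verts finite_subset by blast+
  then have "1 \<le> card X"
    by (simp add: Suc_leI card_gt_0_iff)
  then show ?thesis
    using that X False by simp
qed

end

lemma (in pair_graph_product) car_ge_cross_arms:
  assumes X: "cross_arm G X x p" and Y: "cross_arm H Y y q"
  shows "card X + card Y - 1 \<le> car (G \<box> H)"
proof -
  have "finite X" "finite Y" "x \<in> X" "y \<in> Y"
    using X Y G.pair_finite_verts H.pair_finite_verts finite_subset
    unfolding cross_arm_def by blast+
  then have "card X + card Y - 1 = card (cross X x Y y)"
    by (rule card_cross[symmetric])
  also have "\<dots> \<le> car (G \<box> H)"
    using GH.card_le_car caratheodory_independent_iff_witness caratheodory_witness_cross[OF X Y]
    by blast
  finally show ?thesis .
qed

theorem theorem5p4: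
  fixes G :: "'a pair_pre_digraph" and H :: "'b pair_pre_digraph" and r s :: nat
  assumes "pair_graph G" and "pair_graph H"
    and "Digraph_Component.connected (with_proj G)"
    and "Digraph_Component.connected (with_proj H)"
    and "card (pverts G) \<ge> 2" and "card (pverts H) \<ge> 2"
    and "r = max_convex_induced_path G" and "s = max_convex_induced_path H"
  shows "car (G \<box> H) \<ge> max (r + s - 1) (car G + car H - 1)"
proof -
  interpret pair_graph_product G H
    using assms(1,2) by (rule pair_graph_product.intro)
  have "r + s - 1 \<le> car (G \<box> H)"
  proof -
    obtain X x p where X: "cross_arm G X x p" "r \<le> card X"
      using G.connected_obtains_cross_arm_max_convex_induced_path assms(3,5,7) by blast
    obtain Y y q where Y: "cross_arm H Y y q" "s \<le> card Y"
      using H.connected_obtains_cross_arm_max_convex_induced_path assms(4,6,8) by blast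
    show ?thesis
      using car_ge_cross_arms[OF X(1) Y(1)] X(2) Y(2) by linarith
  qed
  moreover have "car G + car H - 1 \<le> car (G \<box> H)"
  proof -
    obtain X x p where X: "cross_arm G X x p" "car G \<le> card X"
      using G.connected_obtains_cross_arm_car assms(3,5) by blast
    obtain Y y q where Y: "cross_arm H Y y q" "car H \<le> card Y"
      using H.connected_obtains_cross_arm_car assms(4,6) by blast
    show ?thesis
      using car_ge_cross_arms[OF X(1) Y(1)] X(2) Y(2) by linarith
  qed
  ultimately show ?thesis by simp
qed

end
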